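(* Let $f,m\in R[x]$ be polynomials with $1\le \deg(f)<\deg(m)$, and let $i\ge 1$ be an integer. Suppose that there are polynomials $m_1,m_2,h_1,\alpha,\beta\in R[x]$ and $N\in\mathbb{Z}^+$ such that $$m\equiv m_1m_2 \pmod{p^i},\qquad \alpha f+\beta m_1\equiv 1\pmod{p^i},\qquad f^N\equiv h_1m_2\pmod{p^i}.$$ Define $h_2=h_1^{p}m_2^{p-1}$. Then there are polynomials $m_1',m_2',h_2',\alpha',\beta'\in R[x]$ with $m_1'\equiv m_1$, $m_2'\equiv m_2$, $h_2'\equiv h_2$, $\alpha'\equiv\alpha$, $\beta'\equiv\beta \pmod{p^i}$ such that $$m\equiv m_1'm_2' \pmod{p^{i+1}},\qquad \alpha' f+\beta' m_1'\equiv 1\pmod{p^{i+1}},\qquad f^{Np}\equiv h_2'm_2'\pmod{p^{i+1}}.$$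
   Context: Let $p$ be a prime, let $h\in\mathbb{Z}[t]$ be a monic polynomial of degree $d\ge 1$ that is irreducible modulo $p$, and let $R=\mathbb{Z}[t]/\langle h\rangle$. Congruences modulo $p^j$ between elements of $R[x]$ are modulo the ideal $p^jR[x]$. *)

theory Defs
  imports "HOL-Algebra.Algebra"
begin

definition quot_ring :: "(nat \<Rightarrow> int) \<Rightarrow> (nat \<Rightarrow> int) set ring"
  where "quot_ring h = UP \<Z> Quot (Idl\<^bsub>UP \<Z>\<^esub> {h})"

definition is_monic :: "('a, 'b) ring_scheme \<Rightarrow> (nat \<Rightarrow> 'a) \<Rightarrow> bool"
  where "is_monic R h \<longleftrightarrow> coeff (UP R) h (deg R h) = \<one>\<^bsub>R\<^esub>"

text \<open>\<open>ZMod (int p) a\<close> is the residue class of \<open>a\<close> in \<open>ZFact (int p)\<close>, the field with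
  \<open>p\<close> elements, so the polynomial below is the coefficientwise reduction of \<open>h\<close>.\<close>

definition irreducible_modulo :: "nat \<Rightarrow> (nat \<Rightarrow> int) \<Rightarrow> bool"
  where "irreducible_modulo p h \<longleftrightarrow>
    ring_irreducible\<^bsub>UP (ZFact (int p))\<^esub> (\<lambda>n. ZMod (int p) (coeff (UP \<Z>) h n))"

text \<open>Congruence modulo the principal ideal \<open>k A\<close> of a commutative ring \<open>A\<close>, for an integer
  \<open>k\<close>; it is meant for \<open>a\<close> and \<open>b\<close> in the carrier of \<open>A\<close>.\<close>

definition int_cong :: "('a, 'b) ring_scheme \<Rightarrow> nat \<Rightarrow> 'a \<Rightarrow> 'a \<Rightarrow> bool"
  where "int_cong A k a b \<longleftrightarrow> a \<ominus>\<^bsub>A\<^esub> b \<in> PIdl\<^bsub>A\<^esub> (add_pow A k \<one>\<^bsub>A\<^esub>)"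

end

theory Submission
  imports Defs
begin

text \<open>
  Write \<open>P = p\<^sup>i\<close>. The three congruences modulo \<open>P\<close> are equations with explicit error terms,
  \<open>m = m1 m2 + P e\<close>, \<open>\<alpha> f + \<beta> m1 = 1 + P g\<close> and \<open>f\<^sup>N = h1 m2 + P k\<close>, and each correction sought
  is a multiple of \<open>P\<close>. Because \<open>i \<ge> 1\<close>, the product \<open>P P\<close> is divisible by \<open>P p\<close>, so modulo
  \<open>P p\<close> every condition on the corrections becomes linear. The whole argument is ring
  arithmetic, carried out in a commutative ring for an integer \<open>p \<ge> 2\<close> (\<open>factorisation_lift\<close>).

  For the factorisation, \<open>(m1 + P a) (m2 + P b)\<close> agrees with \<open>m\<close> modulo \<open>P p\<close> as soon as
  \<open>m2 a + m1 b = e\<close> modulo \<open>p\<close>. This is solvable because \<open>m1\<close> and \<open>m2\<close> are coprime modulo \<open>P\<close>: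
  \<open>m1\<close> is coprime to \<open>f\<close>, hence to \<open>f\<^sup>N\<close>, hence to \<open>m2\<close>, which divides \<open>f\<^sup>N\<close> modulo \<open>P\<close>
  (\<open>coprime_to_factor_of_power\<close>). The Bezout relation is then repaired by one Newton
  step: \<open>1 + P g'\<close> times \<open>1 - P g'\<close> is \<open>1\<close> up to a multiple of \<open>P P\<close>.

  The third congruence explains the exponent \<open>p\<close>. The first-order term of
  \<open>(h1 m2 + P k)\<^sup>p\<close> carries the factor \<open>p P\<close> and the later ones the factor \<open>P P\<close>
  (\<open>add_pow_second_order\<close>), so \<open>f\<^bsup>Np\<^esup> = h1\<^sup>p m2\<^sup>p = h2 m2\<close> modulo \<open>P p\<close>. Changing \<open>m2\<close> by \<open>P b\<close> spoils this by \<open>P h2 b\<close>, and since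
  \<open>h2 = h1\<^sup>p m2\<^sup>p\<^sup>-\<^sup>1\<close> is itself a multiple \<open>u m2\<close> of \<open>m2\<close>, changing \<open>h2\<close> by \<open>- P u b\<close> restores it.
\<close>

context cring
begin

lemma int_cong_iff:
  assumes "a \<in> carrier R" "b \<in> carrier R"
  shows "int_cong R k a b \<longleftrightarrow> (\<exists>c \<in> carrier R. a = b \<oplus> ([k] \<cdot> \<one>) \<otimes> c)"
proof -
  have K: "[k] \<cdot> \<one> \<in> carrier R" by simp
  have "a \<ominus> b = c \<otimes> ([k] \<cdot> \<one>) \<longleftrightarrow> a = b \<oplus> ([k] \<cdot> \<one>) \<otimes> c" if "c \<in> carrier R" for c
  proof -
    have "a = b \<oplus> ([k] \<cdot> \<one>) \<otimes> c" if "a \<ominus> b = c \<otimes> ([k] \<cdot> \<one>)"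
    proof -
      have "a = b \<oplus> (a \<ominus> b)" using assms by algebra
      then show ?thesis using that K \<open>c \<in> carrier R\<close> by (simp add: m_comm)
    qed
    moreover have "(b \<oplus> ([k] \<cdot> \<one>) \<otimes> c) \<ominus> b = c \<otimes> ([k] \<cdot> \<one>)"
      using assms K that by algebra
    ultimately show ?thesis by blast
  qed
  then show ?thesis
    unfolding int_cong_def cgenideal_def by blast
qed

lemma add_pow_one_mult: "[(j * k :: nat)] \<cdot> \<one> = ([j] \<cdot> \<one>) \<otimes> ([k] \<cdot> \<one>)"
  using add_pow_ldistr[of \<one> "[k] \<cdot> \<one>" j] add.nat_pow_pow[of \<one> j k]
  by (simp add: mult.commute)

lemma add_pow_first_order:
  assumes a: "a \<in> carrier R" and b: "b \<in> carrier R"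
  shows "\<exists>c \<in> carrier R. (a \<oplus> b) [^] (n :: nat) = a [^] n \<oplus> b \<otimes> c"
proof (induction n)
  case 0
  show ?case by (rule bexI[of _ \<zero>]) (use b in auto)
next
  case (Suc n)
  then obtain c where c: "c \<in> carrier R" and e: "(a \<oplus> b) [^] n = a [^] n \<oplus> b \<otimes> c" by blast
  have an: "a [^] n \<in> carrier R" using a by simp
  have "(a \<oplus> b) [^] Suc n = a [^] Suc n \<oplus> b \<otimes> (c \<otimes> (a \<oplus> b) \<oplus> a [^] n)"
    unfolding nat_pow_Suc e using a b c an by algebra
  then show ?case using a b c an by blast
qed

text \<open>
  The binomial expansion is kept only up to first order; for \<open>Suc n = p\<close> and \<open>b\<close> a multiple of
  \<open>p\<^sup>i\<close> the linear term gains one more factor \<open>p\<close>. The exponent is a successor so that the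
  power of \<open>a\<close> in the linear term needs no truncated subtraction.
\<close>

lemma add_pow_second_order:
  assumes a: "a \<in> carrier R" and b: "b \<in> carrier R"
  shows "\<exists>c \<in> carrier R. (a \<oplus> b) [^] Suc n =
           a [^] Suc n \<oplus> ([Suc n] \<cdot> \<one>) \<otimes> a [^] n \<otimes> b \<oplus> b \<otimes> b \<otimes> c"
proof (induction n)
  case 0
  show ?case by (rule bexI[of _ \<zero>]) (use a b in auto)
next
  case (Suc n)
  then obtain c where c: "c \<in> carrier R" and e: "(a \<oplus> b) [^] Suc n =
           a [^] Suc n \<oplus> ([Suc n] \<cdot> \<one>) \<otimes> a [^] n \<otimes> b \<oplus> b \<otimes> b \<otimes> c" by blast
  have an: "a [^] n \<in> carrier R" "[Suc n] \<cdot> \<one> \<in> carrier R" using a by auto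
  have s: "[Suc (Suc n)] \<cdot> \<one> = [Suc n] \<cdot> \<one> \<oplus> \<one>" by simp
  have p: "a [^] Suc (Suc n) = a [^] n \<otimes> a \<otimes> a" "a [^] Suc n = a [^] n \<otimes> a" by simp_all
  have "(a \<oplus> b) [^] Suc (Suc n) = (a \<oplus> b) [^] Suc n \<otimes> (a \<oplus> b)" by (rule nat_pow_Suc)
  also have "\<dots> = a [^] Suc (Suc n) \<oplus> ([Suc (Suc n)] \<cdot> \<one>) \<otimes> a [^] Suc n \<otimes> b
      \<oplus> b \<otimes> b \<otimes> (c \<otimes> (a \<oplus> b) \<oplus> ([Suc n] \<cdot> \<one>) \<otimes> a [^] n)"
    unfolding e s p using a b c an by algebra
  finally show ?case using a b c an by blast
qed

text \<open>
  Raising the Bezout relation of \<open>f\<close> and \<open>m1\<close> to the power \<open>N\<close> leaves one term with \<open>f\<^sup>N\<close>, which is a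
  multiple of \<open>m2\<close> modulo \<open>P\<close>; all other terms are multiples of \<open>m1\<close>.
\<close>

lemma coprime_to_factor_of_power:
  assumes car: "P \<in> carrier R" "f \<in> carrier R" "\<alpha> \<in> carrier R" "\<beta> \<in> carrier R" "m1 \<in> carrier R"
      "m2 \<in> carrier R" "h1 \<in> carrier R" "g \<in> carrier R" "k \<in> carrier R"
    and bez: "\<alpha> \<otimes> f \<oplus> \<beta> \<otimes> m1 = \<one> \<oplus> P \<otimes> g"
    and pow: "f [^] (N :: nat) = h1 \<otimes> m2 \<oplus> P \<otimes> k"
  obtains s t w where "s \<in> carrier R" "t \<in> carrier R" "w \<in> carrier R"
    "s \<otimes> m2 \<oplus> t \<otimes> m1 = \<one> \<oplus> P \<otimes> w"
proof -
  obtain c where c: "c \<in> carrier R"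
    "(\<alpha> \<otimes> f \<oplus> \<beta> \<otimes> m1) [^] N = (\<alpha> \<otimes> f) [^] N \<oplus> \<beta> \<otimes> m1 \<otimes> c"
    using add_pow_first_order[of "\<alpha> \<otimes> f" "\<beta> \<otimes> m1" N] car by auto
  obtain g' where g': "g' \<in> carrier R" "(\<one> \<oplus> P \<otimes> g) [^] N = \<one> \<oplus> P \<otimes> g \<otimes> g'"
    using add_pow_first_order[of \<one> "P \<otimes> g" N] car by auto
  define A where "A = \<alpha> [^] N"
  have A: "A \<in> carrier R" using car by (simp add: A_def)
  have *: "A \<otimes> (h1 \<otimes> m2 \<oplus> P \<otimes> k) \<oplus> \<beta> \<otimes> m1 \<otimes> c = \<one> \<oplus> P \<otimes> g \<otimes> g'"
    using c(2) g'(2) bez pow car by (simp add: nat_pow_distrib A_def)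
  have "A \<otimes> h1 \<otimes> m2 \<oplus> \<beta> \<otimes> c \<otimes> m1
      = (A \<otimes> (h1 \<otimes> m2 \<oplus> P \<otimes> k) \<oplus> \<beta> \<otimes> m1 \<otimes> c) \<ominus> P \<otimes> k \<otimes> A"
    using car A c(1) by algebra
  also have "\<dots> = \<one> \<oplus> P \<otimes> (g \<otimes> g' \<ominus> k \<otimes> A)"
    unfolding * using car A g'(1) by algebra
  finally show thesis
    using that[of "A \<otimes> h1" "\<beta> \<otimes> c" "g \<otimes> g' \<ominus> k \<otimes> A"] car A c(1) g'(1) by simp
qed

text \<open>
  A Hensel step: the common precision of the factorisation, of the Bezout relation and of the
  divisibility of a power of \<open>f\<close> by \<open>m2\<close> grows by one factor \<open>p\<close>, at the price of the exponent
  \<open>N p\<close> in the last one.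
\<close>

lemma factorisation_lift:
  fixes p i N :: nat
  assumes p: "p \<ge> 2" and i: "i \<ge> 1"
    and car: "f \<in> carrier R" "m \<in> carrier R" "m1 \<in> carrier R" "m2 \<in> carrier R"
      "h1 \<in> carrier R" "\<alpha> \<in> carrier R" "\<beta> \<in> carrier R"
    and fac: "int_cong R (p ^ i) m (m1 \<otimes> m2)"
    and bez: "int_cong R (p ^ i) (\<alpha> \<otimes> f \<oplus> \<beta> \<otimes> m1) \<one>"
    and pow: "int_cong R (p ^ i) (f [^] N) (h1 \<otimes> m2)"
  shows "\<exists>m1' \<in> carrier R. \<exists>m2' \<in> carrier R. \<exists>h2' \<in> carrier R.
         \<exists>\<alpha>' \<in> carrier R. \<exists>\<beta>' \<in> carrier R.
           int_cong R (p ^ i) m1' m1 \<and> int_cong R (p ^ i) m2' m2 \<and>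
           int_cong R (p ^ i) h2' (h1 [^] p \<otimes> m2 [^] (p - 1)) \<and>
           int_cong R (p ^ i) \<alpha>' \<alpha> \<and> int_cong R (p ^ i) \<beta>' \<beta> \<and>
           int_cong R (p ^ (i + 1)) m (m1' \<otimes> m2') \<and>
           int_cong R (p ^ (i + 1)) (\<alpha>' \<otimes> f \<oplus> \<beta>' \<otimes> m1') \<one> \<and>
           int_cong R (p ^ (i + 1)) (f [^] (N * p)) (h2' \<otimes> m2')"
proof -
  define P where "P = [(p ^ i)] \<cdot> \<one>"
  define q where "q = [p] \<cdot> \<one>"
  define r where "r = [(p ^ (i - 1))] \<cdot> \<one>"
  have Pq: "P \<in> carrier R" "q \<in> carrier R" "r \<in> carrier R"
    by (auto simp: P_def q_def r_def)
  have Pqr: "P = q \<otimes> r"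
  proof -
    have "p ^ i = p * p ^ (i - 1)" using i by (cases i) auto
    then show ?thesis unfolding P_def q_def r_def by (simp only: add_pow_one_mult)
  qed
  have congP: "int_cong R (p ^ i) a b" if "a = b \<oplus> P \<otimes> c" "b \<in> carrier R" "c \<in> carrier R" for a b c
    using that Pq int_cong_iff[of a b "p ^ i"] unfolding P_def by auto
  have congPq: "int_cong R (p ^ (i + 1)) a b"
    if "a = b \<oplus> P \<otimes> q \<otimes> c" "b \<in> carrier R" "c \<in> carrier R" for a b c
  proof -
    have "[(p ^ (i + 1))] \<cdot> \<one> = P \<otimes> q"
      unfolding P_def q_def add_pow_one_mult[symmetric] by (simp add: mult.commute)
    then show ?thesis using that Pq int_cong_iff[of a b "p ^ (i + 1)"] by auto
  qed
  obtain e where e: "e \<in> carrier R" "m = m1 \<otimes> m2 \<oplus> P \<otimes> e"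
    using fac int_cong_iff car unfolding P_def by (metis m_closed)
  obtain g where g: "g \<in> carrier R" "\<alpha> \<otimes> f \<oplus> \<beta> \<otimes> m1 = \<one> \<oplus> P \<otimes> g"
    using bez int_cong_iff car unfolding P_def by (metis m_closed a_closed one_closed)
  obtain k where k: "k \<in> carrier R" "f [^] N = h1 \<otimes> m2 \<oplus> P \<otimes> k"
    using pow int_cong_iff car unfolding P_def by (metis m_closed nat_pow_closed)
  obtain s t w where stw: "s \<in> carrier R" "t \<in> carrier R" "w \<in> carrier R"
      and st: "s \<otimes> m2 \<oplus> t \<otimes> m1 = \<one> \<oplus> P \<otimes> w"
    using coprime_to_factor_of_power[OF Pq(1) car(1,6,7,3,4,5) g(1) k(1) g(2) k(2)] by blast

  \<comment> \<open>Modulo \<open>P\<close>, multiplying \<open>s m2 + t m1 = 1\<close> by \<open>e\<close> solves the linear equation for the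
    corrections of \<open>m1\<close> and \<open>m2\<close>.\<close>
  define b where "b = t \<otimes> e"
  define m1' where "m1' = m1 \<oplus> P \<otimes> (s \<otimes> e)"
  define m2' where "m2' = m2 \<oplus> P \<otimes> b"
  have bc: "b \<in> carrier R" and mc: "m1' \<in> carrier R" "m2' \<in> carrier R"
    unfolding b_def m1'_def m2'_def using Pq stw e(1) car by auto
  have M: "int_cong R (p ^ (i + 1)) m (m1' \<otimes> m2')"
  proof (rule congPq)
    let ?c = "\<ominus> (r \<otimes> (w \<otimes> e \<oplus> s \<otimes> e \<otimes> b))"
    have "m1' \<otimes> m2' = m1 \<otimes> m2 \<oplus> P \<otimes> ((s \<otimes> m2 \<oplus> t \<otimes> m1) \<otimes> e) \<oplus> P \<otimes> P \<otimes> (s \<otimes> e \<otimes> b)"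
      unfolding m1'_def m2'_def b_def using Pq(1) stw e(1) car by algebra
    then have "m1' \<otimes> m2' = m1 \<otimes> m2 \<oplus> P \<otimes> ((\<one> \<oplus> P \<otimes> w) \<otimes> e) \<oplus> P \<otimes> P \<otimes> (s \<otimes> e \<otimes> b)"
      unfolding st .
    also have "\<dots> = (m1 \<otimes> m2 \<oplus> P \<otimes> e) \<oplus> P \<otimes> (P \<otimes> (w \<otimes> e \<oplus> s \<otimes> e \<otimes> b))"
      using Pq(1) stw e(1) car bc by algebra
    also have "\<dots> = m \<oplus> P \<otimes> (q \<otimes> r \<otimes> (w \<otimes> e \<oplus> s \<otimes> e \<otimes> b))"
      unfolding e(2)[symmetric] Pqr[symmetric] ..
    finally show "m = m1' \<otimes> m2' \<oplus> P \<otimes> q \<otimes> ?c"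
      using Pq stw e(1) car(2) bc by algebra
    show "m1' \<otimes> m2' \<in> carrier R" "?c \<in> carrier R" using mc Pq stw e(1) bc by auto
  qed

  \<comment> \<open>\<open>g'\<close> is the Bezout error after \<open>m1\<close> has been replaced by \<open>m1'\<close>; the new coefficients
    are the old ones times \<open>1 - P g'\<close>.\<close>
  define g' where "g' = g \<oplus> \<beta> \<otimes> (s \<otimes> e)"
  define \<alpha>' where "\<alpha>' = \<alpha> \<oplus> P \<otimes> \<ominus> (g' \<otimes> \<alpha>)"
  define \<beta>' where "\<beta>' = \<beta> \<oplus> P \<otimes> \<ominus> (g' \<otimes> \<beta>)"
  have gc: "g' \<in> carrier R" and ac: "\<alpha>' \<in> carrier R" "\<beta>' \<in> carrier R"
    unfolding g'_def \<alpha>'_def \<beta>'_def using Pq stw e(1) g(1) car by auto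
  have B: "int_cong R (p ^ (i + 1)) (\<alpha>' \<otimes> f \<oplus> \<beta>' \<otimes> m1') \<one>"
  proof (rule congPq)
    let ?c = "\<ominus> (r \<otimes> g' \<otimes> g')"
    have "\<alpha> \<otimes> f \<oplus> \<beta> \<otimes> m1' = (\<alpha> \<otimes> f \<oplus> \<beta> \<otimes> m1) \<oplus> P \<otimes> (\<beta> \<otimes> (s \<otimes> e))"
      unfolding m1'_def using Pq(1) stw e(1) car by algebra
    also have "\<dots> = \<one> \<oplus> P \<otimes> g'"
      unfolding g(2) g'_def using Pq(1) stw e(1) g(1) car by algebra
    finally have 1: "\<alpha> \<otimes> f \<oplus> \<beta> \<otimes> m1' = \<one> \<oplus> P \<otimes> g'" .
    have "\<alpha>' \<otimes> f \<oplus> \<beta>' \<otimes> m1' = (\<alpha> \<otimes> f \<oplus> \<beta> \<otimes> m1') \<otimes> (\<one> \<ominus> P \<otimes> g')"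
      unfolding \<alpha>'_def \<beta>'_def using Pq(1) mc(1) gc car by algebra
    also have "\<dots> = \<one> \<oplus> P \<otimes> (P \<otimes> \<ominus> (g' \<otimes> g'))"
      unfolding 1 using Pq(1) gc by algebra
    also have "\<dots> = \<one> \<oplus> P \<otimes> (q \<otimes> r \<otimes> \<ominus> (g' \<otimes> g'))" unfolding Pqr[symmetric] ..
    also have "\<dots> = \<one> \<oplus> P \<otimes> q \<otimes> ?c" using Pq gc by algebra
    finally show "\<alpha>' \<otimes> f \<oplus> \<beta>' \<otimes> m1' = \<one> \<oplus> P \<otimes> q \<otimes> ?c" .
    show "\<one> \<in> carrier R" "?c \<in> carrier R" using Pq gc by auto
  qed

  \<comment> \<open>\<open>u\<close> is the cofactor of \<open>m2\<close> in \<open>h2\<close>; it exists because \<open>p \<ge> 2\<close>.\<close>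
  define u where "u = h1 [^] p \<otimes> m2 [^] (p - 2)"
  define h2 where "h2 = h1 [^] p \<otimes> m2 [^] (p - 1)"
  define h2' where "h2' = h2 \<oplus> P \<otimes> \<ominus> (u \<otimes> b)"
  have uc: "u \<in> carrier R" using car by (simp add: u_def)
  have h2u: "h2 = u \<otimes> m2"
  proof -
    have "p - 1 = Suc (p - 2)" using p by simp
    then show ?thesis unfolding h2_def u_def using car by (simp add: m_assoc)
  qed
  have hc: "h2 \<in> carrier R" "h2' \<in> carrier R"
    unfolding h2'_def h2u using uc car bc Pq by auto
  have H: "int_cong R (p ^ (i + 1)) (f [^] (N * p)) (h2' \<otimes> m2')"
  proof -
    define x where "x = h1 \<otimes> m2"
    have xc: "x \<in> carrier R" using car by (simp add: x_def)
    have xp: "x [^] p = u \<otimes> m2 \<otimes> m2"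
    proof -
      have "p = Suc (Suc (p - 2))" using p by simp
      then have "m2 [^] p = m2 [^] (p - 2) \<otimes> m2 \<otimes> m2" by (metis nat_pow_Suc)
      then show ?thesis unfolding x_def u_def using car by (simp add: nat_pow_distrib m_assoc)
    qed
    define y where "y = x [^] (p - 1)"
    have yc: "y \<in> carrier R" using xc by (simp add: y_def)
    obtain z where z: "z \<in> carrier R" "(x \<oplus> P \<otimes> k) [^] p =
        x [^] p \<oplus> q \<otimes> y \<otimes> (P \<otimes> k) \<oplus> (P \<otimes> k) \<otimes> (P \<otimes> k) \<otimes> z"
      using add_pow_second_order[of x "P \<otimes> k" "p - 1"] xc Pq k(1) p
      by (auto simp: q_def y_def)
    \<comment> \<open>The error is the first-order binomial term, the remainder of the expansion, and minus
      the product of the corrections of \<open>h2\<close> and \<open>m2\<close>.\<close>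
    let ?c = "y \<otimes> k \<oplus> r \<otimes> k \<otimes> k \<otimes> z \<oplus> r \<otimes> u \<otimes> b \<otimes> b"
    have "f [^] (N * p) = (x \<oplus> P \<otimes> k) [^] p"
      using car k(2) nat_pow_pow[of f N p] by (simp add: x_def)
    also have "\<dots> = u \<otimes> m2 \<otimes> m2 \<oplus> P \<otimes> q \<otimes> (y \<otimes> k) \<oplus> P \<otimes> (P \<otimes> (k \<otimes> k \<otimes> z))"
      unfolding z(2) xp using z(1) yc uc car Pq k(1) by algebra
    also have "\<dots> = h2' \<otimes> m2' \<oplus> P \<otimes> q \<otimes> (y \<otimes> k) \<oplus> P \<otimes> (P \<otimes> (k \<otimes> k \<otimes> z \<oplus> u \<otimes> b \<otimes> b))"
      unfolding h2'_def m2'_def h2u using z(1) yc uc car Pq k(1) bc by algebra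
    also have "\<dots> = h2' \<otimes> m2' \<oplus> P \<otimes> q \<otimes> (y \<otimes> k) \<oplus> P \<otimes> (q \<otimes> r \<otimes> (k \<otimes> k \<otimes> z \<oplus> u \<otimes> b \<otimes> b))"
      unfolding Pqr[symmetric] ..
    also have "\<dots> = h2' \<otimes> m2' \<oplus> P \<otimes> q \<otimes> ?c"
      using z(1) yc uc Pq k(1) bc hc mc by algebra
    finally show ?thesis
      by (rule congPq) (use z(1) yc uc Pq k(1) bc hc mc in auto)
  qed

  have "int_cong R (p ^ i) m1' m1" "int_cong R (p ^ i) m2' m2" "int_cong R (p ^ i) h2' h2"
    "int_cong R (p ^ i) \<alpha>' \<alpha>" "int_cong R (p ^ i) \<beta>' \<beta>"
    by (rule congP[OF m1'_def] congP[OF m2'_def] congP[OF h2'_def] congP[OF \<alpha>'_def] congP[OF \<beta>'_def];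
        use car hc stw e(1) bc uc gc in simp)+
  then show ?thesis using M B H mc hc ac unfolding h2_def by blast
qed

end

lemma cring_quot_ring:
  assumes "h \<in> carrier (UP \<Z>)"
  shows "cring (quot_ring h)"
proof -
  interpret UP_cring \<Z> "UP \<Z>"
    by unfold_locales
  show ?thesis
    unfolding quot_ring_def
    using assms by (intro ideal.quotient_is_cring P.genideal_ideal UP_cring) auto
qed

theorem theorem6:
  fixes p d i N :: nat
    and h :: "nat \<Rightarrow> int"
    and R :: "(nat \<Rightarrow> int) set ring"
    and Rx :: "((nat \<Rightarrow> int) set, nat \<Rightarrow> (nat \<Rightarrow> int) set) up_ring"
    and f m m1 m2 h1 h2 \<alpha> \<beta> :: "nat \<Rightarrow> (nat \<Rightarrow> int) set"
  assumes "Factorial_Ring.prime p"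
    and "h \<in> carrier (UP \<Z>)" and "is_monic \<Z> h" and "deg \<Z> h = d" and "d \<ge> 1"
    and "irreducible_modulo p h"
    and "R = quot_ring h" and "Rx = UP R"
    and "f \<in> carrier Rx" and "m \<in> carrier Rx"
    and "1 \<le> deg R f" and "deg R f < deg R m"
    and "i \<ge> 1" and "N \<ge> 1"
    and "m1 \<in> carrier Rx" and "m2 \<in> carrier Rx" and "h1 \<in> carrier Rx"
    and "\<alpha> \<in> carrier Rx" and "\<beta> \<in> carrier Rx"
    and "int_cong Rx (p ^ i) m (m1 \<otimes>\<^bsub>Rx\<^esub> m2)"
    and "int_cong Rx (p ^ i) (\<alpha> \<otimes>\<^bsub>Rx\<^esub> f \<oplus>\<^bsub>Rx\<^esub> \<beta> \<otimes>\<^bsub>Rx\<^esub> m1) \<one>\<^bsub>Rx\<^esub>"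
    and "int_cong Rx (p ^ i) (f [^]\<^bsub>Rx\<^esub> N) (h1 \<otimes>\<^bsub>Rx\<^esub> m2)"
    and "h2 = h1 [^]\<^bsub>Rx\<^esub> p \<otimes>\<^bsub>Rx\<^esub> m2 [^]\<^bsub>Rx\<^esub> (p - 1)"
  shows "\<exists>m1' \<in> carrier Rx. \<exists>m2' \<in> carrier Rx. \<exists>h2' \<in> carrier Rx.
         \<exists>\<alpha>' \<in> carrier Rx. \<exists>\<beta>' \<in> carrier Rx.
           int_cong Rx (p ^ i) m1' m1 \<and> int_cong Rx (p ^ i) m2' m2 \<and>
           int_cong Rx (p ^ i) h2' h2 \<and>
           int_cong Rx (p ^ i) \<alpha>' \<alpha> \<and> int_cong Rx (p ^ i) \<beta>' \<beta> \<and>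
           int_cong Rx (p ^ (i + 1)) m (m1' \<otimes>\<^bsub>Rx\<^esub> m2') \<and>
           int_cong Rx (p ^ (i + 1))
             (\<alpha>' \<otimes>\<^bsub>Rx\<^esub> f \<oplus>\<^bsub>Rx\<^esub> \<beta>' \<otimes>\<^bsub>Rx\<^esub> m1') \<one>\<^bsub>Rx\<^esub> \<and>
           int_cong Rx (p ^ (i + 1)) (f [^]\<^bsub>Rx\<^esub> (N * p)) (h2' \<otimes>\<^bsub>Rx\<^esub> m2')"
proof -
  have "cring Rx"
    using assms(2,7,8) UP_cring.UP_cring[of R] cring_quot_ring[of h] UP_cring.intro[of R] by simp
  moreover have "p \<ge> 2"
    using assms(1) prime_ge_2_nat by blast
  ultimately show ?thesis
    using cring.factorisation_lift[of Rx p i f m m1 m2 h1 \<alpha> \<beta> N] assms(9-) by simp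
qed

end
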